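(* Let $\mathcal{N}_{br}(z)$ be an LTI network over a field $\mathbb{F}$ with one transmitter $tx$, relays $1,\dots,v$, and two receivers $rx1,rx2$, with channel matrices $H_{i,j}$. Let $d_{ax1},d_{ax2}$ be positive integers and let $K_{tx1}(z)\in\mathbb{F}(z)^{d_{tx}\times d_{ax1}}$, $K_{tx2}(z)\in\mathbb{F}(z)^{d_{tx}\times d_{ax2}}$, $K_i(z)\in\mathbb{F}(z)^{d_{i,in}\times d_{i,out}}$ ($1\le i\le v$), $K_{rx1}(z)\in\mathbb{F}(z)^{d_{ax1}\times d_{rx1}}$, $K_{rx2}(z)\in\mathbb{F}(z)^{d_{ax2}\times d_{rx2}}$. Assume that $$\begin{bmatrix}I-H_{1,1}K_1&\cdots&-H_{v,1}K_v\\ \vdots&\ddots&\vdots\\-H_{1,v}K_1&\cdots&I-H_{v,v}K_v\end{bmatrix}$$ (evaluated at $K_i=K_i(z)$) is invertible. Let $d=d_{rx1}+d_{rx2}+\sum_{i=1}^vd_{i,out}$. Then for all nonnegative integers $d_1,d_2,d_3,d_4$, the four conditions (i) $\operatorname{rank}K_{rx1}(z)G_{tx,rx1}(z,K(z))K_{tx1}(z)\ge d_1$, (ii) $\operatorname{rank}K_{rx2}(z)G_{tx,rx2}(z,K(z))K_{tx2}(z)\ge d_2$, (iii) $\operatorname{rank}K_{rx2}(z)G_{tx,rx2}(z,K(z))K_{tx1}(z)\le d_3$, (iv) $\operatorname{rank}K_{rx1}(z)G_{tx,rx1}(z,K(z))K_{tx2}(z)\le d_4$ all hold if and only if the four conditions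 (a) $\operatorname{rank}G_{tx',rx11'}(z,K(z))\ge d+d_1$, (b) $\operatorname{rank}G_{tx',rx22'}(z,K(z))\ge d+d_2$, (c) $\operatorname{rank}G_{tx',rx12'}(z,K(z))\le d+d_3$, (d) $\operatorname{rank}G_{tx',rx21'}(z,K(z))\le d+d_4$ all hold.
   Context: $\mathbb{F}(z)$ is the field of rational functions in $z$ over $\mathbb{F}$. The transmitter has $d_{tx}$ channel inputs, receiver $k$ has $d_{rxk}$ channel outputs, relay $i$ has $d_{i,in}$ channel inputs and $d_{i,out}$ channel outputs. Channel matrices $H_{i,j}$ over $\mathbb{F}(z)$ from $i\in\{tx,1,\dots,v\}$ to $j\in\{1,\dots,v,rx1,rx2\}$ are given (rows = outputs of $j$, columns = inputs of $i$). The transfer matrix from $tx$ to $rxk$ with relay gains $K_i$ is $$G_{tx,rxk}(z,K)=H_{tx,rxk}+\begin{bmatrix}H_{1,rxk}K_1&\cdots&H_{v,rxk}K_v\end{bmatrix}\left(I-\begin{bmatrix}H_{1,1}K_1&\cdots&H_{v,1}K_v\\ \vdots&\ddots&\vdots\\ H_{1,v}K_1&\cdots&H_{v,v}K_v\end{bmatrix}\right)^{-1}\begin{bmatrix}H_{tx,1}\\ \vdots\\ H_{tx,v}\end{bmatrix},$$ and $K(z)$ means that each gain matrix is replaced by the given matrix over $\mathbb{F}(z)$. Linearized matrices: blocks are of sizes $d_{ax1},d_{ax2},d_{rx1},d_{rx2},d_{1,out},\dots,d_{v,out}$ in this order. $A=\operatorname{diag}(0,0,I,I,I,\dots,I)$.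 $B_{tx1}=B_{tx2}=[0;0;H_{tx,rx1};H_{tx,rx2};H_{tx,1};\dots;H_{tx,v}]$; for $1\le i\le v$, $B_i=[0;0;H_{i,rx1};H_{i,rx2};H_{i,1};\dots;H_{i,v}]$; $B_{rx1}=[I;0;0;\dots;0]$, $B_{rx2}=[0;I;0;\dots;0]$ (block columns). $C_{tx1},C_{tx2},C_{rx1},C_{rx2},C_i$ are the block rows with $-I$ in the first, second, third, fourth, and $(4+i)$-th block respectively and zeros elsewhere. Define $$G_{tx',rx11'}=A+\sum_{i=1}^vB_iK_iC_i+B_{tx1}K_{tx1}C_{tx1}+B_{rx1}K_{rx1}C_{rx1},$$ $$G_{tx',rx22'}=A+\sum_{i=1}^vB_iK_iC_i+B_{tx2}K_{tx2}C_{tx2}+B_{rx2}K_{rx2}C_{rx2},$$ $$G_{tx',rx12'}=A+\sum_{i=1}^vB_iK_iC_i+B_{tx1}K_{tx1}C_{tx1}+B_{rx2}K_{rx2}C_{rx2},$$ $$G_{tx',rx21'}=A+\sum_{i=1}^vB_iK_iC_i+B_{tx2}K_{tx2}C_{tx2}+B_{rx1}K_{rx1}C_{rx1}.$$ These are the transfer matrices of an acyclic single-hop relay network from a common transmitter $tx'$ to four receivers. All ranks are over $\mathbb{F}(z)$. *)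

theory Defs
  imports
    "HOL-Computational_Algebra.Fraction_Field"
    "HOL-Computational_Algebra.Polynomial"
    "Jordan_Normal_Form.DL_Rank"
    "Jordan_Normal_Form.Gauss_Jordan_Elimination"
begin

definition mat_rank :: "'a::field mat \<Rightarrow> nat" where
  "mat_rank A = vec_space.rank (dim_row A) A"

definition mat_inv :: "'a::field mat \<Rightarrow> 'a mat" where
  "mat_inv A = the (mat_inverse A)"

section \<open>Block matrices\<close>

text \<open>Given consecutive blocks labelled by a list, with the block labelled \<open>l\<close> having size
  \<open>sz l\<close>, \<open>locate\<close> maps a global index to the label of the block it lies in and its offset
  inside that block.\<close>

fun locate :: "('l \<Rightarrow> nat) \<Rightarrow> 'l list \<Rightarrow> nat \<Rightarrow> 'l \<times> nat" where
  "locate sz [] i = undefined"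
| "locate sz (l # ls) i = (if i < sz l then (l, i) else locate sz ls (i - sz l))"

text \<open>The matrix with row blocks labelled by \<open>rs\<close> and column blocks labelled by \<open>cs\<close> whose
  block at \<open>(r, c)\<close> is \<open>f r c\<close>, a matrix of size \<open>rsz r\<close> times \<open>csz c\<close>.  Carrying the sizes
  explicitly gives the right dimensions also when \<open>rs\<close> or \<open>cs\<close> is empty.\<close>

definition block_mat ::
  "('r \<Rightarrow> nat) \<Rightarrow> ('c \<Rightarrow> nat) \<Rightarrow> 'r list \<Rightarrow> 'c list \<Rightarrow> ('r \<Rightarrow> 'c \<Rightarrow> 'a mat) \<Rightarrow> 'a mat" where
  "block_mat rsz csz rs cs f =
    mat (sum_list (map rsz rs)) (sum_list (map csz cs))
      (\<lambda>(i, j). case (locate rsz rs i, locate csz cs j) of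
        ((r, a), (c, b)) \<Rightarrow> f r c $$ (a, b))"

lemma block_mat_carrier [simp]:
  "block_mat rsz csz rs cs f
     \<in> carrier_mat (sum_list (map rsz rs)) (sum_list (map csz cs))"
  by (simp add: block_mat_def)

lemma block_mat_four_block:
  assumes "f r r \<in> carrier_mat (rsz r) (csz r)" "f s s \<in> carrier_mat (rsz s) (csz s)"
  shows "block_mat rsz csz [r, s] [r, s] f = four_block_mat (f r r) (f r s) (f s r) (f s s)"
  using assms by (intro eq_matI) (auto simp: block_mat_def)

section \<open>Networks with one transmitter, relays and two receivers\<close>

datatype user = U1 | U2

datatype node = Tx | Relay nat | Rx user

text \<open>Channel matrices have entries in \<open>'f\<close>; an LTI network over a field \<open>'a\<close> is the case
  \<open>'f = 'a poly fract\<close>, the field of rational functions over \<open>'a\<close>.  \<open>n_in N i\<close> and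
  \<open>n_out N j\<close> are the numbers of channel inputs and channel outputs of a node:
  \<open>n_in N Tx\<close> is \<open>d\<^sub>t\<^sub>x\<close>, \<open>n_out N (Rx k)\<close> is \<open>d\<^sub>r\<^sub>x\<^sub>k\<close>, and \<open>n_in N (Relay i)\<close>,
  \<open>n_out N (Relay i)\<close> are \<open>d\<^sub>i\<^sub>,\<^sub>i\<^sub>n\<close>, \<open>d\<^sub>i\<^sub>,\<^sub>o\<^sub>u\<^sub>t\<close>.  The channel matrix \<open>chan N i j\<close> is
  \<open>H\<^sub>i\<^sub>,\<^sub>j\<close>, from node \<open>i\<close> to node \<open>j\<close>.  Values at other arguments play no role.\<close>

record 'f network =
  n_relays :: nat
  n_in :: "node \<Rightarrow> nat"
  n_out :: "node \<Rightarrow> nat"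
  chan :: "node \<Rightarrow> node \<Rightarrow> 'f mat"

definition relays :: "'f::field network \<Rightarrow> nat list" where
  "relays N = [1..<Suc (n_relays N)]"

definition senders :: "'f::field network \<Rightarrow> node set" where
  "senders N = insert Tx (Relay ` {1..n_relays N})"

definition listeners :: "'f::field network \<Rightarrow> node set" where
  "listeners N = Relay ` {1..n_relays N} \<union> range Rx"

definition lti_network :: "'f::field network \<Rightarrow> bool" where
  "lti_network N \<longleftrightarrow>
    (\<forall>i \<in> senders N. \<forall>j \<in> listeners N. chan N i j \<in> carrier_mat (n_out N j) (n_in N i))"

abbreviation relay_out :: "'f::field network \<Rightarrow> nat \<Rightarrow> nat" where
  "relay_out N i \<equiv> n_out N (Relay i)"

definition relay_loop ::
  "'f::field network \<Rightarrow> (nat \<Rightarrow> 'f mat) \<Rightarrow> 'f mat" where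
  "relay_loop N K = block_mat (relay_out N) (relay_out N) (relays N) (relays N)
    (\<lambda>j i. chan N (Relay i) (Relay j) * K i)"

definition relays_to_rx ::
  "'f::field network \<Rightarrow> (nat \<Rightarrow> 'f mat) \<Rightarrow> user \<Rightarrow> 'f mat" where
  "relays_to_rx N K k = block_mat (\<lambda>_. n_out N (Rx k)) (relay_out N) [()] (relays N)
    (\<lambda>_ i. chan N (Relay i) (Rx k) * K i)"

definition tx_to_relays :: "'f::field network \<Rightarrow> 'f mat" where
  "tx_to_relays N = block_mat (relay_out N) (\<lambda>_. n_in N Tx) (relays N) [()]
    (\<lambda>j _. chan N Tx (Relay j))"

definition transfer ::
  "'f::field network \<Rightarrow> (nat \<Rightarrow> 'f mat) \<Rightarrow> user \<Rightarrow> 'f mat" where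
  "transfer N K k = chan N Tx (Rx k) +
    relays_to_rx N K k
      * mat_inv (1\<^sub>m (\<Sum>i = 1..n_relays N. relay_out N i) - relay_loop N K)
      * tx_to_relays N"

text \<open>The matrix that is inverted in \<open>transfer\<close>, with the identity distributed over the
  blocks.\<close>

definition loop_mat ::
  "'f::field network \<Rightarrow> (nat \<Rightarrow> 'f mat) \<Rightarrow> 'f mat" where
  "loop_mat N K = block_mat (relay_out N) (relay_out N) (relays N) (relays N)
    (\<lambda>j i. if i = j then 1\<^sub>m (relay_out N j) - chan N (Relay i) (Relay j) * K i
           else - (chan N (Relay i) (Relay j) * K i))"

section \<open>The linearized single-hop network\<close>

text \<open>Block labels of the linearized matrices: \<open>Aux k\<close> for the block of size
  \<open>d\<^sub>a\<^sub>x\<^sub>k\<close>, \<open>Out j\<close> for the block of channel outputs of the node \<open>j\<close>.\<close>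

datatype block = Aux user | Out node

fun block_size :: "'f::field network \<Rightarrow> (user \<Rightarrow> nat) \<Rightarrow> block \<Rightarrow> nat" where
  "block_size N dax (Aux k) = dax k"
| "block_size N dax (Out j) = n_out N j"

definition blocks :: "'f::field network \<Rightarrow> block list" where
  "blocks N = [Aux U1, Aux U2, Out (Rx U1), Out (Rx U2)] @ map (\<lambda>i. Out (Relay i)) (relays N)"

definition lin_dim :: "'f::field network \<Rightarrow> (user \<Rightarrow> nat) \<Rightarrow> nat" where
  "lin_dim N dax = sum_list (map (block_size N dax) (blocks N))"

definition lin_A :: "'f::field network \<Rightarrow> (user \<Rightarrow> nat) \<Rightarrow> 'f mat" where
  "lin_A N dax = block_mat (block_size N dax) (block_size N dax) (blocks N) (blocks N)
    (\<lambda>p q. if p = q \<and> p \<notin> range Aux then 1\<^sub>m (block_size N dax p)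
           else 0\<^sub>m (block_size N dax p) (block_size N dax q))"

text \<open>\<open>lin_B N dax Tx\<close> is \<open>B\<^sub>t\<^sub>x\<^sub>1 = B\<^sub>t\<^sub>x\<^sub>2\<close> and \<open>lin_B N dax (Relay i)\<close> is \<open>B\<^sub>i\<close>.\<close>

definition lin_B :: "'f::field network \<Rightarrow> (user \<Rightarrow> nat) \<Rightarrow> node \<Rightarrow> 'f mat" where
  "lin_B N dax s = block_mat (block_size N dax) (\<lambda>_. n_in N s) (blocks N) [()]
    (\<lambda>p _. case p of Aux k \<Rightarrow> 0\<^sub>m (dax k) (n_in N s) | Out j \<Rightarrow> chan N s j)"

definition lin_Brx :: "'f::field network \<Rightarrow> (user \<Rightarrow> nat) \<Rightarrow> user \<Rightarrow> 'f mat" where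
  "lin_Brx N dax k = block_mat (block_size N dax) (\<lambda>_. dax k) (blocks N) [()]
    (\<lambda>p _. if p = Aux k then 1\<^sub>m (dax k) else 0\<^sub>m (block_size N dax p) (dax k))"

text \<open>\<open>C\<^sub>t\<^sub>x\<^sub>k\<close>, \<open>C\<^sub>r\<^sub>x\<^sub>k\<close> and \<open>C\<^sub>i\<close> are \<open>lin_C N dax b\<close> with \<open>b\<close> being \<open>Aux k\<close>,
  \<open>Out (Rx k)\<close> and \<open>Out (Relay i)\<close>.\<close>

definition lin_C :: "'f::field network \<Rightarrow> (user \<Rightarrow> nat) \<Rightarrow> block \<Rightarrow> 'f mat" where
  "lin_C N dax b = block_mat (\<lambda>_. block_size N dax b) (block_size N dax) [()] (blocks N)
    (\<lambda>_ q. if q = b then - 1\<^sub>m (block_size N dax b)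
           else 0\<^sub>m (block_size N dax b) (block_size N dax q))"

text \<open>\<open>lin_transfer N dax Ktx Krx K k l\<close> is \<open>G\<^sub>t\<^sub>x\<^sub>'\<^sub>,\<^sub>r\<^sub>x\<^sub>k\<^sub>l\<^sub>'\<close>: the gains of
  the transmitter for user \<open>k\<close> and of receiver \<open>l\<close> enter.  The \<open>finsum\<close> is the sum of matrices of
  size \<open>lin_dim N dax\<close>.\<close>

definition lin_transfer ::
  "'f::field network \<Rightarrow> (user \<Rightarrow> nat) \<Rightarrow> (user \<Rightarrow> 'f mat) \<Rightarrow> (user \<Rightarrow> 'f mat)
    \<Rightarrow> (nat \<Rightarrow> 'f mat) \<Rightarrow> user \<Rightarrow> user \<Rightarrow> 'f mat" where
  "lin_transfer N dax Ktx Krx K k l =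
    lin_A N dax
    + finsum (ring_mat TYPE('f) (lin_dim N dax) ())
        (\<lambda>i. lin_B N dax (Relay i) * K i * lin_C N dax (Out (Relay i))) {1..n_relays N}
    + lin_B N dax Tx * Ktx k * lin_C N dax (Aux k)
    + lin_Brx N dax l * Krx l * lin_C N dax (Out (Rx l))"

end

theory Submission
  imports Defs "Jordan_Normal_Form.Matrix_Kernel"
begin

text \<open>In the block form given by the auxiliary, receiver and relay blocks, the linearized transfer
  matrix for users \<open>k\<close>, \<open>l\<close> is
  \<open>[[0, -P, 0], [-Q, I, -R], [-S, 0, L]]\<close>, where \<open>L\<close> is the invertible loop matrix.  Taking the Schur complement of \<open>L\<close> turns \<open>-Q\<close> into
  \<open>-(Q + R L\<^sup>-\<^sup>1 S)\<close>, which contains \<open>- G\<^sub>t\<^sub>x\<^sub>,\<^sub>r\<^sub>x\<^sub>m K\<^sub>t\<^sub>x\<^sub>k\<close>; taking the Schur complement of the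
  identity leaves a matrix whose only nonzero block is \<open>- K\<^sub>r\<^sub>x\<^sub>l G\<^sub>t\<^sub>x\<^sub>,\<^sub>r\<^sub>x\<^sub>l K\<^sub>t\<^sub>x\<^sub>k\<close>.  Both steps
  remove exactly the size of the eliminated block from the rank, hence the rank of the linearized
  matrix is \<open>d + rank (K\<^sub>r\<^sub>x\<^sub>l G\<^sub>t\<^sub>x\<^sub>,\<^sub>r\<^sub>x\<^sub>l K\<^sub>t\<^sub>x\<^sub>k)\<close>.\<close>

section \<open>Rank of matrices\<close>

text \<open>The rank-nullity theorem for the linear map given by \<open>A\<close>: its image is the
  column space and its kernel is \<open>mat_kernel A\<close>. Rank identities can then be derived by
  comparing kernels.\<close>

lemma mat_rank_nullity:
  fixes A :: "'a::field mat"
  assumes A: "A \<in> carrier_mat nr nc"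
  shows "mat_rank A + kernel_dim A = nc"
proof -
  interpret V: vec_space "TYPE('a)" nc .
  interpret W: vec_space "TYPE('a)" nr .
  interpret T: linear_map class_ring "module_vec TYPE('a) nc" "module_vec TYPE('a) nr"
    "\<lambda>v. A *\<^sub>v v"
  proof (intro linear_map.intro mod_hom.intro mod_hom_axioms.intro vec_vs vec_module)
    show "(\<lambda>v. A *\<^sub>v v) \<in> LinearCombinations.module_hom class_ring (module_vec TYPE('a) nc) (module_vec TYPE('a) nr)"
      using A mult_add_distrib_mat_vec[OF A] mult_mat_vec[OF A]
      by (auto simp: LinearCombinations.module_hom_def module_vec_simps class_ring_simps)
  qed
  have im: "T.imT = W.span (set (cols A))"
    using W.col_space_eq[OF A] A
    unfolding W.col_space_def T.mod_hom.im_def by (auto simp: module_vec_simps)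
  have ker: "T.kerT = mat_kernel A"
    using A unfolding T.mod_hom.ker_def mat_kernel_def by (auto simp: module_vec_simps)
  show ?thesis
    using T.rank_nullity[OF V.fin_dim] A
    unfolding im ker mat_rank_def kernel_dim_def V.dim_is_n by (auto simp: W.rank_def)
qed

text \<open>A left inverse of \<open>E\<close> recovers \<open>X\<close> from \<open>E * X\<close>,
  so both matrices have the same kernel; they also have the same number of columns. \<open>E\<close>
  may be rectangular, as it is for the selector matrices used later.\<close>

lemma mat_rank_mult_left_inverse:
  fixes X :: "'a::field mat"
  assumes E: "E \<in> carrier_mat m n" and F: "F \<in> carrier_mat n m" and X: "X \<in> carrier_mat n c"
    and FE: "F * E = 1\<^sub>m n"
  shows "mat_rank (E * X) = mat_rank X"
proof -
  have "F * (E * X) = X"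
    using E F X FE by (simp flip: assoc_mult_mat)
  then have "mat_kernel (E * X) = mat_kernel X"
    using mat_kernel_mult_subset[OF X E] mat_kernel_mult_subset[of "E * X" m c F n] E F X
    by auto
  then have "kernel_dim (E * X) = kernel_dim X"
    using X E by (simp add: kernel_dim_def)
  then show ?thesis
    using mat_rank_nullity[OF X] mat_rank_nullity[of "E * X" m c] X E by auto
qed

text \<open>Dual to the previous lemma, with column spaces in place of kernels: every
  \<open>X v\<close> equals \<open>(X E) (F v)\<close>, and every \<open>(X E) v\<close> equals
  \<open>X (E v)\<close>.\<close>

lemma mat_rank_mult_right_inverse:
  fixes X :: "'a::field mat"
  assumes X: "X \<in> carrier_mat r n" and E: "E \<in> carrier_mat n m" and F: "F \<in> carrier_mat m n"
    and EF: "E * F = 1\<^sub>m n"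
  shows "mat_rank (X * E) = mat_rank X"
proof -
  interpret W: vec_space "TYPE('a)" r .
  have XE: "X * E \<in> carrier_mat r m" using X E by simp
  have "X *\<^sub>v v = (X * E) *\<^sub>v (F *\<^sub>v v)" if v: "v \<in> carrier_vec n" for v
  proof -
    have "E *\<^sub>v (F *\<^sub>v v) = v"
      using assoc_mult_mat_vec[OF E F v] EF v by simp
    then show ?thesis
      using assoc_mult_mat_vec[OF X E, of "F *\<^sub>v v"] F v by simp
  qed
  moreover have "(X * E) *\<^sub>v v = X *\<^sub>v (E *\<^sub>v v)" if v: "v \<in> carrier_vec m" for v
    using assoc_mult_mat_vec[OF X E v] .
  ultimately have "W.col_space (X * E) = W.col_space X"
    unfolding W.col_space_eq[OF X] W.col_space_eq[OF XE] using X E F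
    by auto
  then show ?thesis
    using X E by (simp add: mat_rank_def W.rank_def W.col_space_def)
qed

lemma mat_rank_uminus:
  fixes X :: "'a::field mat"
  shows "mat_rank (- X) = mat_rank X"
proof -
  have "mat_rank (- 1\<^sub>m (dim_row X) * X) = mat_rank X"
    by (rule mat_rank_mult_left_inverse[of _ "dim_row X" "dim_row X" "- 1\<^sub>m (dim_row X)" _ "dim_col X"])
      auto
  then show ?thesis by simp
qed

section \<open>Rank and Schur complements\<close>

text \<open>The kernel dimension of a block diagonal matrix is the sum over its diagonal blocks, and
  the identity contributes none. The \<open>n\<close> additional columns therefore all count towards
  the rank.\<close>

lemma mat_rank_diag_one:
  fixes S :: "'a::field mat"
  assumes S: "S \<in> carrier_mat m m"
  shows "mat_rank (four_block_mat S (0\<^sub>m m n) (0\<^sub>m n m) (1\<^sub>m n)) = mat_rank S + n"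
proof -
  let ?M = "four_block_mat S (0\<^sub>m m n) (0\<^sub>m n m) (1\<^sub>m n)"
  have M: "?M \<in> carrier_mat (m + n) (m + n)" using S by simp
  have "kernel_dim ?M = kernel_dim S"
    using kernel_four_block_0_mat[OF refl S one_carrier_mat] kernel_one_mat(1)[where 'a = 'a] S
    by (simp add: kernel_dim_def)
  then show ?thesis
    using mat_rank_nullity[OF M] mat_rank_nullity[OF S] by linarith
qed

lemma mat_rank_schur_complement:
  fixes A B C D :: "'a::field mat"
  assumes A: "A \<in> carrier_mat m m" and B: "B \<in> carrier_mat m n"
    and C: "C \<in> carrier_mat n m" and D: "D \<in> carrier_mat n n"
    and J: "J \<in> carrier_mat n n" and DJ: "D * J = 1\<^sub>m n"
  shows "mat_rank (four_block_mat A B C D) = mat_rank (A - B * J * C) + n"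
proof -
  \<comment> \<open>The matrix is \<open>[[1, B J], [0, 1]] * diag(A - B J C, 1) * [[1, 0], [C, D]]\<close>.\<close>
  define S X Y where S_def: "S = A - B * J * C" and X_def: "X = B * J" and Y_def: "Y = J * C"
  let ?L = "four_block_mat (1\<^sub>m m) X (0\<^sub>m n m) (1\<^sub>m n)"
  let ?L' = "four_block_mat (1\<^sub>m m) (- X) (0\<^sub>m n m) (1\<^sub>m n)"
  let ?M = "four_block_mat S (0\<^sub>m m n) (0\<^sub>m n m) (1\<^sub>m n)"
  let ?R = "four_block_mat (1\<^sub>m m) (0\<^sub>m m n) C D"
  let ?R' = "four_block_mat (1\<^sub>m m) (0\<^sub>m m n) (- Y) J"
  note mult = mult_four_block_mat[of _ m m _ n _ n _ _ m _ n]
  \<comment> \<open>For square matrices over a field a right inverse is also a left inverse. Both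
    orders are used: \<open>J * D = 1\<close> for the block \<open>B\<close>,
    \<open>D * J = 1\<close> for the block \<open>C\<close>.\<close>
  have JD: "J * D = 1\<^sub>m n" by (rule mat_mult_left_right_inverse[OF D J DJ])
  have X: "X \<in> carrier_mat m n" and Y: "Y \<in> carrier_mat n m"
    and XC: "X * C \<in> carrier_mat m m"
    using B C J by (auto simp: X_def Y_def)
  have S: "S \<in> carrier_mat m m" and SXC: "S + X * C = A"
    using A X C XC by (auto simp: S_def X_def[symmetric] intro!: eq_matI minus_carrier_mat)
  have XD: "X * D = B" using B J D JD by (simp add: X_def assoc_mult_mat[OF B J D])
  have DY: "D * Y = C" using D J C DJ by (simp add: Y_def flip: assoc_mult_mat)
  have "?L * ?M = four_block_mat S X (0\<^sub>m n m) (1\<^sub>m n)"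
    by (subst mult) (use S X in simp_all)
  also have "\<dots> * ?R = four_block_mat A B C D"
    by (subst mult) (use S X XD B C D SXC in simp_all)
  finally have eq: "four_block_mat A B C D = ?L * ?M * ?R" ..
  \<comment> \<open>The outer factors are block triangular with invertible diagonal blocks, so their
    inverses \<open>?L'\<close> and \<open>?R'\<close> can be written down explicitly and do not
    change the rank.\<close>
  have LL: "?L' * ?L = 1\<^sub>m (m + n)"
  proof -
    have "X + - X = 0\<^sub>m m n" using X by (intro eq_matI) auto
    then show ?thesis by (subst mult) (use X in simp_all)
  qed
  have RR: "?R * ?R' = 1\<^sub>m (m + n)"
  proof -
    have "C - C = 0\<^sub>m n m" using C by (intro eq_matI) auto
    moreover have "C + D * (- Y) = 0\<^sub>m n m"
      using C D Y DY by (intro eq_matI) auto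
    moreover have "1\<^sub>m m + - 0\<^sub>m m m = (1\<^sub>m m :: 'a mat)" by (intro eq_matI) auto
    ultimately show ?thesis by (subst mult) (use C D J Y DJ in simp_all)
  qed
  have cL: "?L \<in> carrier_mat (m + n) (m + n)" and cL': "?L' \<in> carrier_mat (m + n) (m + n)"
    and cM: "?M \<in> carrier_mat (m + n) (m + n)" and cR: "?R \<in> carrier_mat (m + n) (m + n)"
    and cR': "?R' \<in> carrier_mat (m + n) (m + n)"
    using S D J by simp_all
  have "mat_rank (four_block_mat A B C D) = mat_rank (?L * ?M)"
    unfolding eq by (rule mat_rank_mult_right_inverse[OF mult_carrier_mat[OF cL cM] cR cR' RR])
  also have "\<dots> = mat_rank ?M"
    by (rule mat_rank_mult_left_inverse[OF cL cL' cM LL])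
  finally show ?thesis using mat_rank_diag_one[OF S] by (simp add: S_def)
qed

section \<open>Block matrices\<close>

lemma locate_bounds:
  "i < sum_list (map sz ls) \<Longrightarrow> locate sz ls i = (l, a) \<Longrightarrow> l \<in> set ls \<and> a < sz l"
proof (induction ls arbitrary: i)
  case (Cons k ls)
  then show ?case
    using Cons.IH[of "i - sz k"] by (cases "i < sz k") (auto simp: less_diff_conv2)
qed simp

lemma locate_append:
  "locate sz (xs @ ys) i =
    (if i < sum_list (map sz xs) then locate sz xs i else locate sz ys (i - sum_list (map sz xs)))"
  by (induction xs arbitrary: i) (auto simp: diff_diff_add)

text \<open>Turns the sum over a global middle index in a matrix product into a sum over block
  labels of sums inside the blocks.\<close>

lemma sum_locate:
  fixes h :: "'l \<Rightarrow> nat \<Rightarrow> 'a::comm_monoid_add"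
  shows "(\<Sum>i<sum_list (map sz ls). case locate sz ls i of (l, a) \<Rightarrow> h l a) =
    (\<Sum>l\<leftarrow>ls. \<Sum>a<sz l. h l a)"
proof (induction ls)
  case (Cons l ls)
  have split: "sum g {..<m + n} = sum g {..<m} + (\<Sum>i<n. g (m + i))" for g :: "nat \<Rightarrow> 'a" and m n
    by (induction n) (simp_all add: add.assoc)
  have "(\<Sum>a<sz l. case locate sz (l # ls) a of (l, a) \<Rightarrow> h l a) = (\<Sum>a<sz l. h l a)"
    by (rule sum.cong) auto
  then show ?case using Cons.IH by (simp add: split)
qed simp

lemma dim_block_mat [simp]:
  "dim_row (block_mat rsz csz rs cs f) = sum_list (map rsz rs)"
  "dim_col (block_mat rsz csz rs cs f) = sum_list (map csz cs)"
  by (simp_all add: block_mat_def)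

lemma block_mat_index:
  assumes "i < sum_list (map rsz rs)" "j < sum_list (map csz cs)"
    "locate rsz rs i = (r, a)" "locate csz cs j = (c, b)"
  shows "block_mat rsz csz rs cs f $$ (i, j) = f r c $$ (a, b)"
  using assms by (simp add: block_mat_def)

section \<open>Blockwise equality, linear operations and concatenation\<close>

text \<open>The common route to all block identities: entries are compared at positions already
  resolved into label and offset, which \<open>locate_bounds\<close> shows to be in range. The facts
  available at an entry are, in order, the index bounds, the two locations, the label memberships
  and the offset bounds.\<close>

lemma block_mat_eqI:
  assumes M: "M \<in> carrier_mat (sum_list (map rsz rs)) (sum_list (map csz cs))"
    and eq: "\<And>i j r a c b. i < sum_list (map rsz rs) \<Longrightarrow> j < sum_list (map csz cs) \<Longrightarrow>
      locate rsz rs i = (r, a) \<Longrightarrow> locate csz cs j = (c, b) \<Longrightarrow> r \<in> set rs \<Longrightarrow> c \<in> set cs \<Longrightarrow>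
      a < rsz r \<Longrightarrow> b < csz c \<Longrightarrow> M $$ (i, j) = f r c $$ (a, b)"
  shows "M = block_mat rsz csz rs cs f"
proof (rule eq_matI)
  fix i j
  assume "i < dim_row (block_mat rsz csz rs cs f)" "j < dim_col (block_mat rsz csz rs cs f)"
  then have ij: "i < sum_list (map rsz rs)" "j < sum_list (map csz cs)" by simp_all
  obtain r a c b where l: "locate rsz rs i = (r, a)" "locate csz cs j = (c, b)"
    by (meson surj_pair)
  show "M $$ (i, j) = block_mat rsz csz rs cs f $$ (i, j)"
    using eq[OF ij l] locate_bounds[OF ij(1) l(1)] locate_bounds[OF ij(2) l(2)]
      block_mat_index[OF ij l, of f] by simp
qed (use M in auto)

lemma block_mat_cong:
  assumes "\<And>r c. r \<in> set rs \<Longrightarrow> c \<in> set cs \<Longrightarrow> f r c = g r c"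
  shows "block_mat rsz csz rs cs f = block_mat rsz csz rs cs g"
  by (rule block_mat_eqI[OF block_mat_carrier]) (simp add: block_mat_index assms)

text \<open>A matrix sum takes its dimensions from the second summand, which is why the size
  condition is placed on \<open>g\<close>.\<close>

lemma block_mat_add:
  assumes "\<And>r c. r \<in> set rs \<Longrightarrow> c \<in> set cs \<Longrightarrow> g r c \<in> carrier_mat (rsz r) (csz c)"
  shows "block_mat rsz csz rs cs f + block_mat rsz csz rs cs g =
    block_mat rsz csz rs cs (\<lambda>r c. f r c + g r c)"
proof (rule block_mat_eqI, goal_cases)
  case (2 i j r a c b)
  then show ?case using assms[of r c] by (simp add: block_mat_index)
qed simp

lemma block_mat_minus:
  assumes "\<And>r c. r \<in> set rs \<Longrightarrow> c \<in> set cs \<Longrightarrow> g r c \<in> carrier_mat (rsz r) (csz c)"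
  shows "block_mat rsz csz rs cs f - block_mat rsz csz rs cs g =
    block_mat rsz csz rs cs (\<lambda>r c. f r c - g r c)"
proof (rule block_mat_eqI, goal_cases)
  case (2 i j r a c b)
  then show ?case using assms[of r c] by (simp add: block_mat_index)
qed (simp add: minus_carrier_mat)

lemma block_mat_zero: "block_mat rsz csz rs cs (\<lambda>r c. 0\<^sub>m (rsz r) (csz c)) =
    0\<^sub>m (sum_list (map rsz rs)) (sum_list (map csz cs))"
  by (rule block_mat_eqI[symmetric]) auto

lemma block_mat_unit:
  assumes "X \<in> carrier_mat (rsz ()) (csz ())"
  shows "block_mat rsz csz [()] [()] (\<lambda>_ _. X) = X"
  by (rule block_mat_eqI[symmetric]) (use assms in \<open>auto split: if_splits\<close>)

text \<open>Splitting both label lists yields the two-by-two form to which the Schur complement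
  applies, first with the relays and then with the receivers as lower right part.\<close>

lemma block_mat_append:
  "block_mat rsz csz (rs @ rs') (cs @ cs') f =
    four_block_mat (block_mat rsz csz rs cs f) (block_mat rsz csz rs cs' f)
      (block_mat rsz csz rs' cs f) (block_mat rsz csz rs' cs' f)"
proof (rule block_mat_eqI[symmetric], goal_cases)
  case (2 i j r a c b)
  have "i < sum_list (map rsz rs) \<or> i - sum_list (map rsz rs) < sum_list (map rsz rs')"
    and "j < sum_list (map csz cs) \<or> j - sum_list (map csz cs) < sum_list (map csz cs')"
    using 2(1,2) by auto
  then show ?case
    using 2(1-4)
    by (cases "i < sum_list (map rsz rs)"; cases "j < sum_list (map csz cs)")
      (simp_all add: locate_append block_mat_index)
qed simp

text \<open>Needed for the identity matrix: equal label and offset must force equal global indices,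
  so that the ones of the diagonal blocks lie exactly on the global diagonal.\<close>

lemma locate_inject:
  "distinct ls \<Longrightarrow> i < sum_list (map sz ls) \<Longrightarrow> j < sum_list (map sz ls) \<Longrightarrow>
    locate sz ls i = locate sz ls j \<Longrightarrow> i = j"
proof (induction ls arbitrary: i j)
  case (Cons l ls)
  \<comment> \<open>An index past the first block is located in the tail, where distinctness
    excludes the label \<open>l\<close>; two indices on different sides of that boundary thus get
    different labels.\<close>
  have notin: "fst (locate sz ls (k - sz l)) \<noteq> l" if "k < sum_list (map sz (l # ls))" "\<not> k < sz l" for k
    using that Cons.prems(1) locate_bounds[of "k - sz l" sz ls] by (cases "locate sz ls (k - sz l)") auto
  show ?case
  proof (cases "i < sz l"; cases "j < sz l")
    assume "\<not> i < sz l" "\<not> j < sz l"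
    then show ?thesis using Cons.IH[of "i - sz l" "j - sz l"] Cons.prems by (simp add: less_diff_conv2)
  next
    assume "i < sz l" "\<not> j < sz l"
    then show ?thesis using notin[OF Cons.prems(3)] Cons.prems(4) by (metis fst_conv locate.simps(2))
  next
    assume "\<not> i < sz l" "j < sz l"
    then show ?thesis using notin[OF Cons.prems(2)] Cons.prems(4) by (metis fst_conv locate.simps(2))
  qed (use Cons.prems in auto)
qed simp

lemma block_mat_one:
  assumes "distinct ls"
  shows "block_mat sz sz ls ls (\<lambda>p q. if p = q then 1\<^sub>m (sz p) else 0\<^sub>m (sz p) (sz q)) =
    1\<^sub>m (sum_list (map sz ls))"
proof (rule block_mat_eqI[symmetric], goal_cases)
  case (2 i j r a c b)
  then show ?case using locate_inject[OF assms 2(1,2)] by auto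
qed simp

section \<open>Products with a single contributing middle block\<close>

text \<open>An entry of the product is a sum over middle labels of entries of block products, and
  only \<open>m\<close> survives. All products below are of this kind, which avoids summing a family
  of blocks.\<close>

lemma block_mat_mult_single:
  fixes f :: "'r \<Rightarrow> 'm \<Rightarrow> 'a::comm_ring_1 mat"
  assumes ms: "distinct ms" "m \<in> set ms"
    and f: "\<And>r l. r \<in> set rs \<Longrightarrow> l \<in> set ms \<Longrightarrow> f r l \<in> carrier_mat (rsz r) (msz l)"
    and g: "\<And>l c. c \<in> set cs \<Longrightarrow> l \<in> set ms \<Longrightarrow> g l c \<in> carrier_mat (msz l) (csz c)"
    and 0: "\<And>r l c. r \<in> set rs \<Longrightarrow> l \<in> set ms \<Longrightarrow> c \<in> set cs \<Longrightarrow> l \<noteq> m \<Longrightarrow>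
      f r l * g l c = 0\<^sub>m (rsz r) (csz c)"
  shows "block_mat rsz msz rs ms f * block_mat msz csz ms cs g =
    block_mat rsz csz rs cs (\<lambda>r c. f r m * g m c)"
proof (rule block_mat_eqI, goal_cases)
  case (2 i j r a c b)
  have prod: "(\<Sum>k<msz l. f r l $$ (a, k) * g l c $$ (k, b)) = (f r l * g l c) $$ (a, b)"
    if l: "l \<in> set ms" for l
    using f[OF 2(5) l] g[OF 2(6) l] 2(7,8)
    by (auto simp: scalar_prod_def atLeast0LessThan intro!: sum.cong)
  have "(block_mat rsz msz rs ms f * block_mat msz csz ms cs g) $$ (i, j) =
      (\<Sum>k<sum_list (map msz ms).
        block_mat rsz msz rs ms f $$ (i, k) * block_mat msz csz ms cs g $$ (k, j))"
    using 2(1,2) by (auto simp: scalar_prod_def atLeast0LessThan intro!: sum.cong)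
  also have "\<dots> = (\<Sum>k<sum_list (map msz ms).
      case locate msz ms k of (l, k) \<Rightarrow> f r l $$ (a, k) * g l c $$ (k, b))"
    using 2(1-4) by (intro sum.cong) (auto simp: block_mat_index split: prod.splits)
  also have "\<dots> = (\<Sum>l\<leftarrow>ms. \<Sum>k<msz l. f r l $$ (a, k) * g l c $$ (k, b))"
    by (rule sum_locate)
  also have "\<dots> = (\<Sum>l\<leftarrow>ms. (f r l * g l c) $$ (a, b))"
    using prod by (intro arg_cong[where f = sum_list] map_cong) auto
  also have "\<dots> = (\<Sum>l\<in>set ms. (f r l * g l c) $$ (a, b))"
    by (rule sum_list_distinct_conv_sum_set[OF ms(1)])
  also have "\<dots> = (\<Sum>l\<in>{m}. (f r l * g l c) $$ (a, b))"
    by (rule sum.mono_neutral_right) (use ms 0[OF 2(5) _ 2(6)] 2(7,8) in auto)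
  finally show ?case by simp
qed auto

section \<open>Relabelling and merging of blocks\<close>

lemma locate_map:
  "i < sum_list (map (sz \<circ> h) ls) \<Longrightarrow> locate sz (map h ls) i = apfst h (locate (sz \<circ> h) ls i)"
proof (induction ls arbitrary: i)
  case (Cons l ls)
  then show ?case using Cons.IH[of "i - sz (h l)"] by (simp add: less_diff_conv2)
qed simp

lemma block_mat_map:
  "block_mat rsz csz (map h rs) (map h' cs) f =
    block_mat (rsz \<circ> h) (csz \<circ> h') rs cs (\<lambda>r c. f (h r) (h' c))"
proof (rule block_mat_eqI, goal_cases)
  case (2 i j r a c b)
  have "locate rsz (map h rs) i = (h r, a)" "locate csz (map h' cs) j = (h' c, b)"
    using 2(1-4) by (simp_all add: locate_map)
  then show ?case using 2(1,2) by (simp add: block_mat_index)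
qed (simp flip: map_map)

lemma block_mat_map_rows:
  "block_mat rsz csz (map h rs) cs f = block_mat (rsz \<circ> h) csz rs cs (\<lambda>r. f (h r))"
  using block_mat_map[of rsz csz h rs id cs f] by simp

lemma block_mat_map_cols:
  "block_mat rsz csz rs (map h cs) f = block_mat rsz (csz \<circ> h) rs cs (\<lambda>r c. f r (h c))"
  using block_mat_map[of rsz csz id rs h cs f] by simp

lemma block_mat_uminus:
  assumes "\<And>r c. r \<in> set rs \<Longrightarrow> c \<in> set cs \<Longrightarrow> f r c \<in> carrier_mat (rsz r) (csz c)"
  shows "- block_mat rsz csz rs cs f = block_mat rsz csz rs cs (\<lambda>r c. - f r c)"
proof (rule block_mat_eqI, goal_cases)
  case (2 i j r a c b)
  then show ?case using assms[of r c] by (simp add: block_mat_index)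
qed simp

text \<open>Merges all column blocks into one, so that a whole block row such as
  \<open>relays_to_rx\<close> can be handled as a single matrix.\<close>

lemma block_mat_nest_cols:
  "block_mat rsz csz rs cs f = block_mat rsz (\<lambda>_. sum_list (map csz cs)) rs [()]
    (\<lambda>r _. block_mat (\<lambda>_. rsz r) csz [()] cs (\<lambda>_. f r))"
proof (rule block_mat_eqI, goal_cases)
  case (2 i j r a u b)
  obtain c b' where "locate csz cs j = (c, b')" by (meson surj_pair)
  with 2 show ?case by (simp add: block_mat_index split: if_splits)
qed simp

lemma block_mat_nest_rows:
  "block_mat rsz csz rs cs f = block_mat (\<lambda>_. sum_list (map rsz rs)) csz [()] cs
    (\<lambda>_ c. block_mat rsz (\<lambda>_. csz c) rs [()] (\<lambda>r _. f r c))"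
proof (rule block_mat_eqI, goal_cases)
  case (2 i j u a c b)
  obtain r a' where "locate rsz rs i = (r, a')" by (meson surj_pair)
  with 2 show ?case by (simp add: block_mat_index split: if_splits)
qed simp

section \<open>Block columns times block rows, and finite sums\<close>

lemma block_mat_mult_right:
  fixes X :: "'a::comm_ring_1 mat"
  assumes "\<And>r. r \<in> set rs \<Longrightarrow> f r () \<in> carrier_mat (rsz r) m" "X \<in> carrier_mat m n"
  shows "block_mat rsz (\<lambda>_. m) rs [()] f * X = block_mat rsz (\<lambda>_. n) rs [()] (\<lambda>r _. f r () * X)"
  using block_mat_mult_single[of "[()]" "()" rs f rsz "\<lambda>_. m" "[()]" "\<lambda>_ _. X" "\<lambda>_. n"] assms
  by (simp add: block_mat_unit)

text \<open>The shape of every term \<open>B K C\<close> of the linearized matrix, of the correction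
  term of the relay Schur complement, and of the final embedding of the remaining block.\<close>

lemma block_mat_sandwich:
  fixes X :: "'a::comm_ring_1 mat"
  assumes f: "\<And>r. r \<in> set rs \<Longrightarrow> f r () \<in> carrier_mat (rsz r) m"
    and X: "X \<in> carrier_mat m n"
    and g: "\<And>c. c \<in> set cs \<Longrightarrow> g () c \<in> carrier_mat n (csz c)"
  shows "block_mat rsz (\<lambda>_. m) rs [()] f * X * block_mat (\<lambda>_. n) csz [()] cs g =
    block_mat rsz csz rs cs (\<lambda>r c. f r () * X * g () c)"
proof -
  have "block_mat rsz (\<lambda>_. m) rs [()] f * X = block_mat rsz (\<lambda>_. n) rs [()] (\<lambda>r _. f r () * X)"
    by (rule block_mat_mult_right) (use f X in auto)
  moreover have "f r () * X \<in> carrier_mat (rsz r) n" if "r \<in> set rs" for r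
    using mult_carrier_mat[OF f[OF that] X] .
  ultimately show ?thesis
    by (simp, intro block_mat_mult_single) (use g in auto)
qed

text \<open>The size of a block varies with its labels, so the sum inside a block is taken entrywise
  under \<open>mat\<close>, which fixes the size even for empty \<open>S\<close>.\<close>

lemma finsum_block_mat:
  fixes F :: "'s \<Rightarrow> 'a::comm_ring_1 mat"
  assumes "finite S"
    and "\<And>s. s \<in> S \<Longrightarrow> F s = block_mat sz sz ls ls (G s)"
    and "n = sum_list (map sz ls)"
  shows "finsum (ring_mat TYPE('a) n ()) F S =
    block_mat sz sz ls ls (\<lambda>p q. mat (sz p) (sz q) (\<lambda>ab. \<Sum>s\<in>S. G s p q $$ ab))"
  using assms(1,2)
proof (induction S rule: finite_induct)
  case empty
  interpret ring "ring_mat TYPE('a) n ()" by (rule ring_mat)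
  have "mat x y (\<lambda>_. 0) = (0\<^sub>m x y :: 'a mat)" for x y by (rule eq_matI) auto
  then show ?case
    by (subst finsum_empty) (simp add: ring_mat_simps assms(3) block_mat_zero)
next
  case (insert s S)
  interpret ring "ring_mat TYPE('a) n ()" by (rule ring_mat)
  have "finsum (ring_mat TYPE('a) n ()) F (insert s S) =
      F s + finsum (ring_mat TYPE('a) n ()) F S"
    using insert by (subst finsum_insert) (auto simp: ring_mat_simps assms(3))
  also have "\<dots> = block_mat sz sz ls ls (G s) +
      block_mat sz sz ls ls (\<lambda>p q. mat (sz p) (sz q) (\<lambda>ab. \<Sum>s\<in>S. G s p q $$ ab))"
    using insert by simp
  also have "\<dots> = block_mat sz sz ls ls
      (\<lambda>p q. mat (sz p) (sz q) (\<lambda>ab. \<Sum>s\<in>insert s S. G s p q $$ ab))"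
  proof (rule block_mat_eqI, goal_cases)
    case (2 i j r a c b)
    then show ?case using insert.hyps by (simp add: block_mat_index)
  qed simp
  finally show ?case .
qed

section \<open>Rank of the linearized transfer matrix\<close>

text \<open>The blocks of \<open>lin_transfer\<close> in closed form. The minus signs stem from the
  negative identities in \<open>lin_C\<close>; on the relay diagonal the identity of
  \<open>lin_A\<close> combines with the relay term to a diagonal block of
  \<open>loop_mat\<close>.\<close>

fun lin_block :: "'f::field network \<Rightarrow> (user \<Rightarrow> nat) \<Rightarrow> (user \<Rightarrow> 'f mat) \<Rightarrow> (user \<Rightarrow> 'f mat)
    \<Rightarrow> (nat \<Rightarrow> 'f mat) \<Rightarrow> user \<Rightarrow> user \<Rightarrow> block \<Rightarrow> block \<Rightarrow> 'f mat" where
  "lin_block N dax Ktx Krx K k l (Aux m) (Out (Rx n)) =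
    (if m = l \<and> n = l then - Krx l else 0\<^sub>m (dax m) (n_out N (Rx n)))"
| "lin_block N dax Ktx Krx K k l (Aux m) q = 0\<^sub>m (dax m) (block_size N dax q)"
| "lin_block N dax Ktx Krx K k l (Out j) (Aux m) =
    (if m = k then - (chan N Tx j * Ktx k) else 0\<^sub>m (n_out N j) (dax m))"
| "lin_block N dax Ktx Krx K k l (Out j) (Out (Relay i)) =
    (if Relay i = j then 1\<^sub>m (n_out N j) - chan N (Relay i) j * K i else - (chan N (Relay i) j * K i))"
| "lin_block N dax Ktx Krx K k l (Out j) (Out q) =
    (if j = q then 1\<^sub>m (n_out N j) else 0\<^sub>m (n_out N j) (n_out N q))"

text \<open>Collects the assumptions shared by the four rank computations, which are then done once
  for arbitrary users \<open>k\<close> and \<open>l\<close>.\<close>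

locale linearized_network =
  fixes N :: "'f::field network" and dax :: "user \<Rightarrow> nat"
    and Ktx Krx :: "user \<Rightarrow> 'f mat" and K :: "nat \<Rightarrow> 'f mat"
  assumes lti: "lti_network N"
    and Ktx: "Ktx k \<in> carrier_mat (n_in N Tx) (dax k)"
    and K: "i \<in> {1..n_relays N} \<Longrightarrow> K i \<in> carrier_mat (n_in N (Relay i)) (n_out N (Relay i))"
    and Krx: "Krx k \<in> carrier_mat (dax k) (n_out N (Rx k))"
    and invertible: "invertible_mat (loop_mat N K)"
begin

abbreviation "sz \<equiv> block_size N dax"

abbreviation "aux_blocks \<equiv> [Aux U1, Aux U2]"

abbreviation "rx_blocks \<equiv> [Out (Rx U1), Out (Rx U2)]"

abbreviation "relay_dim \<equiv> sum_list (map (relay_out N) (relays N))"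

lemma set_relays [simp]: "set (relays N) = {1..n_relays N}"
  by (auto simp: relays_def)

lemma distinct_relays [simp]: "distinct (relays N)"
  by (simp add: relays_def)

lemma relay_dim_eq: "relay_dim = (\<Sum>i = 1..n_relays N. relay_out N i)"
  by (simp add: sum_list_distinct_conv_sum_set)

lemma set_blocks: "p \<in> set (blocks N) \<longleftrightarrow>
    (case p of Aux _ \<Rightarrow> True | Out (Relay i) \<Rightarrow> i \<in> {1..n_relays N} | Out (Rx _) \<Rightarrow> True | Out Tx \<Rightarrow> False)"
proof -
  have "m = U1 \<or> m = U2" for m by (cases m) auto
  then show ?thesis by (auto simp: blocks_def split: block.split node.split)
qed

lemma chan_carrier [simp]:
  "i \<in> {1..n_relays N} \<Longrightarrow> Out j \<in> set (blocks N) \<Longrightarrow>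
    chan N (Relay i) j \<in> carrier_mat (n_out N j) (n_in N (Relay i))"
  "Out j \<in> set (blocks N) \<Longrightarrow> chan N Tx j \<in> carrier_mat (n_out N j) (n_in N Tx)"
  using lti unfolding lti_network_def senders_def listeners_def
  by (auto simp: set_blocks split: node.splits)

lemma relay_gain_carrier:
  "i \<in> {1..n_relays N} \<Longrightarrow> Out j \<in> set (blocks N) \<Longrightarrow>
    chan N (Relay i) j * K i \<in> carrier_mat (n_out N j) (relay_out N i)"
  using chan_carrier(1) K by (meson mult_carrier_mat)

lemma tx_gain_carrier:
  "Out j \<in> set (blocks N) \<Longrightarrow> chan N Tx j * Ktx k \<in> carrier_mat (n_out N j) (dax k)"
  using chan_carrier(2) Ktx by (meson mult_carrier_mat)

text \<open>\<open>lin_C\<close> selects one block column and negates it, so the sandwich product is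
  supported in the column of relay \<open>i\<close>. The transmitter and receiver terms are computed
  in the same way.\<close>

lemma lin_relay_term:
  assumes i: "i \<in> {1..n_relays N}"
  shows "lin_B N dax (Relay i) * K i * lin_C N dax (Out (Relay i)) =
    block_mat sz sz (blocks N) (blocks N) (\<lambda>p q. if q = Out (Relay i)
      then (case p of Aux m \<Rightarrow> 0\<^sub>m (sz p) (sz q) | Out j \<Rightarrow> - (chan N (Relay i) j * K i))
      else 0\<^sub>m (sz p) (sz q))"
proof -
  have H: "(case p of Aux m \<Rightarrow> 0\<^sub>m (dax m) (n_in N (Relay i)) | Out j \<Rightarrow> chan N (Relay i) j)
      \<in> carrier_mat (sz p) (n_in N (Relay i))" if "p \<in> set (blocks N)" for p
    using that i by (auto split: block.split)
  have C: "(if q = Out (Relay i) then - 1\<^sub>m (n_out N (Relay i)) else 0\<^sub>m (n_out N (Relay i)) (sz q))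
      \<in> carrier_mat (n_out N (Relay i)) (sz q)" for q
    by auto
  note HK = relay_gain_carrier[OF i]
  show ?thesis
    unfolding lin_B_def lin_C_def block_size.simps
    by (subst block_mat_sandwich[OF H K[OF i] C], assumption)
      (intro block_mat_cong, use K[OF i] HK carrier_matD(1)[OF chan_carrier(1)[OF i]] in \<open>auto split: block.split\<close>)
qed

lemma lin_tx_term:
  "lin_B N dax Tx * Ktx k * lin_C N dax (Aux k) =
    block_mat sz sz (blocks N) (blocks N) (\<lambda>p q. if q = Aux k
      then (case p of Aux m \<Rightarrow> 0\<^sub>m (sz p) (sz q) | Out j \<Rightarrow> - (chan N Tx j * Ktx k))
      else 0\<^sub>m (sz p) (sz q))"
proof -
  have H: "(case p of Aux m \<Rightarrow> 0\<^sub>m (dax m) (n_in N Tx) | Out j \<Rightarrow> chan N Tx j)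
      \<in> carrier_mat (sz p) (n_in N Tx)" if "p \<in> set (blocks N)" for p
    using that by (auto split: block.split)
  have C: "(if q = Aux k then - 1\<^sub>m (dax k) else 0\<^sub>m (dax k) (sz q)) \<in> carrier_mat (dax k) (sz q)" for q
    by auto
  note HK = tx_gain_carrier[of _ k]
  show ?thesis
    unfolding lin_B_def lin_C_def block_size.simps
    by (subst block_mat_sandwich[OF H Ktx C], assumption)
      (intro block_mat_cong, use Ktx[of k] HK carrier_matD(1)[OF chan_carrier(2)] in \<open>auto split: block.split\<close>)
qed

lemma lin_rx_term:
  "lin_Brx N dax l * Krx l * lin_C N dax (Out (Rx l)) =
    block_mat sz sz (blocks N) (blocks N)
      (\<lambda>p q. if p = Aux l \<and> q = Out (Rx l) then - Krx l else 0\<^sub>m (sz p) (sz q))"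
proof -
  have B: "(if p = Aux l then 1\<^sub>m (dax l) else 0\<^sub>m (sz p) (dax l)) \<in> carrier_mat (sz p) (dax l)" for p
    by auto
  have C: "(if q = Out (Rx l) then - 1\<^sub>m (n_out N (Rx l)) else 0\<^sub>m (n_out N (Rx l)) (sz q))
      \<in> carrier_mat (n_out N (Rx l)) (sz q)" for q
    by auto
  show ?thesis
    unfolding lin_Brx_def lin_C_def block_size.simps
    by (subst block_mat_sandwich[OF B Krx C]) (intro block_mat_cong, use Krx[of l] in auto)
qed

lemma lin_transfer_eq_block_mat:
  "lin_transfer N dax Ktx Krx K k l =
    block_mat sz sz (blocks N) (blocks N) (lin_block N dax Ktx Krx K k l)"
proof -
  \<comment> \<open>\<open>?rel\<close> is the total relay contribution: the terms occupy different
    block columns, so the column label alone determines the relay.\<close>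
  let ?rel = "\<lambda>p q. case q of Out (Relay i) \<Rightarrow>
      (case p of Aux m \<Rightarrow> 0\<^sub>m (sz p) (sz q) | Out j \<Rightarrow> - (chan N (Relay i) j * K i))
    | _ \<Rightarrow> 0\<^sub>m (sz p) (sz q)"
  let ?tx = "\<lambda>p q. if q = Aux k
      then (case p of Aux m \<Rightarrow> 0\<^sub>m (sz p) (sz q) | Out j \<Rightarrow> - (chan N Tx j * Ktx k))
      else 0\<^sub>m (sz p) (sz q)"
  let ?rx = "\<lambda>p q. if p = Aux l \<and> q = Out (Rx l) then - Krx l else 0\<^sub>m (sz p) (sz q)"
  note HK = relay_gain_carrier and HT = tx_gain_carrier[of _ k]
  have rel: "?rel p q \<in> carrier_mat (sz p) (sz q)"
    if "p \<in> set (blocks N)" "q \<in> set (blocks N)" for p q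
    using that HK by (auto split: block.split node.split simp: set_blocks)
  have tx: "?tx p q \<in> carrier_mat (sz p) (sz q)" if "p \<in> set (blocks N)" for p q
    using that HT by (auto split: block.split)
  have rx: "?rx p q \<in> carrier_mat (sz p) (sz q)" for p q using Krx[of l] by auto
  have "finsum (ring_mat TYPE('f) (lin_dim N dax) ())
        (\<lambda>i. lin_B N dax (Relay i) * K i * lin_C N dax (Out (Relay i))) {1..n_relays N} =
      block_mat sz sz (blocks N) (blocks N) (\<lambda>p q. mat (sz p) (sz q)
        (\<lambda>ab. \<Sum>i\<in>{1..n_relays N}. (if q = Out (Relay i)
      then (case p of Aux m \<Rightarrow> 0\<^sub>m (sz p) (sz q) | Out j \<Rightarrow> - (chan N (Relay i) j * K i))
      else 0\<^sub>m (sz p) (sz q)) $$ ab))"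
    by (rule finsum_block_mat) (simp_all add: lin_relay_term lin_dim_def)
  also have "\<dots> = block_mat sz sz (blocks N) (blocks N) ?rel"
  proof (rule block_mat_cong)
    fix p q assume p: "p \<in> set (blocks N)" and q: "q \<in> set (blocks N)"
    show "mat (sz p) (sz q) (\<lambda>ab. \<Sum>i\<in>{1..n_relays N}. (if q = Out (Relay i)
        then (case p of Aux m \<Rightarrow> 0\<^sub>m (sz p) (sz q) | Out j \<Rightarrow> - (chan N (Relay i) j * K i))
        else 0\<^sub>m (sz p) (sz q)) $$ ab) = ?rel p q" (is "?l = _")
    proof (rule eq_matI)
      fix a b assume "a < dim_row (?rel p q)" "b < dim_col (?rel p q)"
      then have ab: "a < sz p" "b < sz q" using rel[OF p q] by auto
      show "?l $$ (a, b) = ?rel p q $$ (a, b)"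
      proof (cases "\<exists>i. q = Out (Relay i)")
        case True
        then obtain i where i: "q = Out (Relay i)" "i \<in> {1..n_relays N}"
          using q by (auto simp: set_blocks)
        \<comment> \<open>Among the summands only the one of the relay labelling the column
          \<open>q\<close> is nonzero, which collapses the sum.\<close>
        have "(if q = Out (Relay i')
            then (case p of Aux m \<Rightarrow> 0\<^sub>m (sz p) (sz q) | Out j \<Rightarrow> - (chan N (Relay i') j * K i'))
            else 0\<^sub>m (sz p) (sz q)) $$ (a, b) = (if i' = i then ?rel p q $$ (a, b) else 0)" for i'
          using ab i by auto
        then have "?l $$ (a, b) = (\<Sum>i'\<in>{1..n_relays N}. if i' = i then ?rel p q $$ (a, b) else 0)"
          by (simp only: index_mat(1)[OF ab])
        then show ?thesis using i by simp
      next
        case False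
        then show ?thesis using ab by (auto split: block.split node.split intro!: sum.neutral)
      qed
    qed (use rel[OF p q] in auto)
  qed
  finally have "lin_transfer N dax Ktx Krx K k l =
      lin_A N dax + block_mat sz sz (blocks N) (blocks N) ?rel
      + block_mat sz sz (blocks N) (blocks N) ?tx + block_mat sz sz (blocks N) (blocks N) ?rx"
    by (simp only: lin_transfer_def lin_tx_term lin_rx_term)
  also have "\<dots> = block_mat sz sz (blocks N) (blocks N) (\<lambda>p q.
      (if p = q \<and> p \<notin> range Aux then 1\<^sub>m (sz p) else 0\<^sub>m (sz p) (sz q)) + ?rel p q + ?tx p q + ?rx p q)"
    unfolding lin_A_def
    by (subst block_mat_add[OF rel], assumption, assumption, subst block_mat_add[OF tx], assumption,
        subst block_mat_add[OF rx], rule refl)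
  also have "\<dots> = block_mat sz sz (blocks N) (blocks N) (lin_block N dax Ktx Krx K k l)"
  proof (rule block_mat_cong)
    fix p q assume p: "p \<in> set (blocks N)" and q: "q \<in> set (blocks N)"
    have minus: "1\<^sub>m n + - X = 1\<^sub>m n - X" if "X \<in> carrier_mat n n" for X :: "'f mat" and n
      using that by (intro eq_matI) auto
    show "(if p = q \<and> p \<notin> range Aux then 1\<^sub>m (sz p) else 0\<^sub>m (sz p) (sz q))
        + ?rel p q + ?tx p q + ?rx p q = lin_block N dax Ktx Krx K k l p q"
    proof (cases p)
      case (Aux m)
      then show ?thesis using Krx[of l]
        by (cases q rule: block.exhaust; cases "\<exists>n. q = Out (Rx n)") (auto split: node.split)
    next
      case (Out j)
      show ?thesis
      proof (cases q)
        case (Aux m)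
        then show ?thesis using HT[of j] p Out by auto
      next
        case q': (Out j')
        \<comment> \<open>\<open>Out Tx\<close> does not occur among the blocks, so an output column
          belongs to a relay or to a receiver.\<close>
        then consider i where "j' = Relay i" "i \<in> {1..n_relays N}" | m where "j' = Rx m"
          using q by (auto simp: set_blocks split: node.splits)
        then show ?thesis
        proof cases
          case 1
          then show ?thesis using HK[of i j] p Out q' minus by auto
        next
          case 2
          then show ?thesis using Out q' by auto
        qed
      qed
    qed
  qed
  finally show ?thesis .
qed

section \<open>The loop matrix and its inverse\<close>

lemma size_relay_block: "sz \<circ> (\<lambda>i. Out (Relay i)) = relay_out N"
  by auto

lemma loop_mat_carrier [simp]: "loop_mat N K \<in> carrier_mat relay_dim relay_dim"
  unfolding loop_mat_def by (rule block_mat_carrier)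

text \<open>\<open>mat_inverse\<close> returns an option; invertibility makes the loop matrix a unit
  of the matrix ring, which rules out \<open>None\<close>.\<close>

lemma mat_inv_loop_mat:
  "mat_inv (loop_mat N K) \<in> carrier_mat relay_dim relay_dim"
  "loop_mat N K * mat_inv (loop_mat N K) = 1\<^sub>m relay_dim"
proof -
  let ?L = "loop_mat N K"
  obtain B where B: "?L * B = 1\<^sub>m relay_dim" "B * ?L = 1\<^sub>m (dim_row B)"
    using invertible carrier_matD(1)[OF loop_mat_carrier]
    unfolding invertible_mat_def inverts_mat_def by auto
  \<comment> \<open>The inverse comes without stated dimensions; they are read off from the sizes of
    the two products.\<close>
  have "dim_col (?L * B) = relay_dim" "dim_col (B * ?L) = dim_row B"
    unfolding B by simp_all
  then have "B \<in> carrier_mat relay_dim relay_dim"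
    using carrier_matD(2)[OF loop_mat_carrier] by auto
  then have "?L \<in> Units (ring_mat TYPE('f) relay_dim ())"
    using B by (auto simp: Units_def ring_mat_simps)
  then obtain J where "mat_inverse ?L = Some J"
    using mat_inverse(1)[OF loop_mat_carrier, where b = "()"] by blast
  then show "mat_inv ?L \<in> carrier_mat relay_dim relay_dim"
    "?L * mat_inv ?L = 1\<^sub>m relay_dim"
    using mat_inverse(2)[OF loop_mat_carrier] by (auto simp: mat_inv_def)
qed

text \<open>Identifies the matrix inverted in \<open>transfer\<close> with the one assumed
  invertible, by writing the identity in block form.\<close>

lemma loop_mat_eq: "1\<^sub>m relay_dim - relay_loop N K = loop_mat N K"
proof -
  have "1\<^sub>m relay_dim - relay_loop N K =
    block_mat (relay_out N) (relay_out N) (relays N) (relays N)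
      (\<lambda>j i. if j = i then 1\<^sub>m (relay_out N j) else 0\<^sub>m (relay_out N j) (relay_out N i))
    - relay_loop N K"
    by (simp only: block_mat_one[OF distinct_relays])
  also have "\<dots> = block_mat (relay_out N) (relay_out N) (relays N) (relays N)
      (\<lambda>j i. (if j = i then 1\<^sub>m (relay_out N j) else 0\<^sub>m (relay_out N j) (relay_out N i))
        - chan N (Relay i) (Relay j) * K i)"
    unfolding relay_loop_def
    by (rule block_mat_minus) (use relay_gain_carrier in \<open>auto simp: set_blocks\<close>)
  also have "\<dots> = loop_mat N K"
    unfolding loop_mat_def
  proof (rule block_mat_cong)
    fix j i assume "j \<in> set (relays N)" "i \<in> set (relays N)"
    then have "chan N (Relay i) (Relay j) * K i \<in> carrier_mat (relay_out N j) (relay_out N i)"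
      using relay_gain_carrier[of i "Relay j"] by (simp add: set_blocks)
    moreover have "0\<^sub>m r c - X = - X" if "X \<in> carrier_mat r c" for X :: "'f mat" and r c
      using that by (intro eq_matI) auto
    ultimately show "(if j = i then 1\<^sub>m (relay_out N j) else 0\<^sub>m (relay_out N j) (relay_out N i))
          - chan N (Relay i) (Relay j) * K i =
        (if i = j then 1\<^sub>m (relay_out N j) - chan N (Relay i) (Relay j) * K i
         else - (chan N (Relay i) (Relay j) * K i))"
      by auto
  qed
  finally show ?thesis .
qed

lemma relays_to_rx_carrier: "relays_to_rx N K m \<in> carrier_mat (n_out N (Rx m)) relay_dim"
  unfolding relays_to_rx_def carrier_mat_def by simp

lemma tx_to_relays_carrier: "tx_to_relays N \<in> carrier_mat relay_dim (n_in N Tx)"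
  unfolding tx_to_relays_def carrier_mat_def by simp

lemma transfer_eq: "transfer N K m = chan N Tx (Rx m) +
    relays_to_rx N K m * mat_inv (loop_mat N K) * tx_to_relays N"
  unfolding transfer_def relay_dim_eq[symmetric] loop_mat_eq ..

lemma chan_tx_rx_carrier: "chan N Tx (Rx m) \<in> carrier_mat (n_out N (Rx m)) (n_in N Tx)"
  using chan_carrier(2)[of "Rx m"] by (simp add: set_blocks)

lemma transfer_carrier: "transfer N K m \<in> carrier_mat (n_out N (Rx m)) (n_in N Tx)"
  unfolding transfer_eq
  by (meson add_carrier_mat mult_carrier_mat relays_to_rx_carrier mat_inv_loop_mat(1) tx_to_relays_carrier)

section \<open>Elimination of the relays\<close>

text \<open>What remains of the auxiliary and receiver blocks after the Schur complement of the loop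
  matrix. Only receiver rows in column \<open>Aux k\<close> change: there the paths through the
  relays complete the direct channel to the full transfer matrix.\<close>

fun eliminated_block :: "user \<Rightarrow> user \<Rightarrow> block \<Rightarrow> block \<Rightarrow> 'f mat" where
  "eliminated_block k l (Out (Rx m)) (Aux n) =
    (if n = k then - (transfer N K m * Ktx k) else 0\<^sub>m (n_out N (Rx m)) (dax n))"
| "eliminated_block k l p q = lin_block N dax Ktx Krx K k l p q"

abbreviation "relay_blocks \<equiv> map (\<lambda>i. Out (Relay i)) (relays N)"

text \<open>The inverse of the loop matrix is available only as a whole. Merging the relay columns
  here, and the relay rows in the next lemma, puts the Schur correction into sandwich form with that
  inverse in the middle.\<close>

lemma lin_block_relay_columns:
  "block_mat sz sz (aux_blocks @ rx_blocks) relay_blocks (lin_block N dax Ktx Krx K k l) =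
    block_mat sz (\<lambda>_. relay_dim) (aux_blocks @ rx_blocks) [()]
      (\<lambda>p _. case p of Out (Rx m) \<Rightarrow> - relays_to_rx N K m | _ \<Rightarrow> 0\<^sub>m (sz p) relay_dim)"
proof -
  have rx: "block_mat (\<lambda>_. n_out N (Rx m)) (relay_out N) [()] (relays N)
      (\<lambda>_ i. lin_block N dax Ktx Krx K k l (Out (Rx m)) (Out (Relay i))) = - relays_to_rx N K m" for m
    unfolding relays_to_rx_def
    by (subst block_mat_uminus) (use relay_gain_carrier in \<open>auto simp: set_blocks intro!: block_mat_cong\<close>)
  have aux: "block_mat (\<lambda>_. dax m) (relay_out N) [()] (relays N)
      (\<lambda>_ i. lin_block N dax Ktx Krx K k l (Aux m) (Out (Relay i))) = 0\<^sub>m (dax m) relay_dim" for m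
    using block_mat_zero[of "\<lambda>_. dax m" "relay_out N" "[()]" "relays N"] by simp
  show ?thesis
    unfolding block_mat_map_cols size_relay_block
      block_mat_nest_cols[of sz "relay_out N" "aux_blocks @ rx_blocks"]
    by (rule block_mat_cong) (use rx aux in auto)
qed

lemma lin_block_relay_rows:
  "block_mat sz sz relay_blocks (aux_blocks @ rx_blocks) (lin_block N dax Ktx Krx K k l) =
    block_mat (\<lambda>_. relay_dim) sz [()] (aux_blocks @ rx_blocks)
      (\<lambda>_ q. if q = Aux k then - (tx_to_relays N * Ktx k) else 0\<^sub>m relay_dim (sz q))"
proof -
  have H: "chan N Tx (Relay j) \<in> carrier_mat (relay_out N j) (n_in N Tx)" if "j \<in> set (relays N)" for j
    using that chan_carrier(2)[of "Relay j"] by (simp add: set_blocks)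
  have tx: "block_mat (relay_out N) (\<lambda>_. dax k) (relays N) [()]
      (\<lambda>j _. - (chan N Tx (Relay j) * Ktx k)) = - (tx_to_relays N * Ktx k)"
    unfolding tx_to_relays_def
    by (subst block_mat_mult_right[OF H Ktx], assumption, subst block_mat_uminus)
      (use H Ktx in \<open>auto intro!: mult_carrier_mat\<close>)
  have zero: "block_mat (relay_out N) (\<lambda>_. c) (relays N) [()]
      (\<lambda>j _. 0\<^sub>m (relay_out N j) c) = 0\<^sub>m relay_dim c" for c
    using block_mat_zero[of "relay_out N" "\<lambda>_. c" "relays N" "[()]"] by simp
  show ?thesis
    unfolding block_mat_map_rows size_relay_block
      block_mat_nest_rows[of "relay_out N" sz _ "aux_blocks @ rx_blocks"]
  proof (rule block_mat_cong, goal_cases)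
    case (1 u q)
    show ?case
    proof (cases "q = Aux k")
      case False
      then have "lin_block N dax Ktx Krx K k l (Out (Relay j)) q = 0\<^sub>m (relay_out N j) (sz q)" for j
        using 1(2) by auto
      with False show ?thesis using zero by simp
    qed (use tx in simp)
  qed
qed

text \<open>Unless \<open>p\<close> is a receiver and \<open>q\<close> is \<open>Aux k\<close>, an
  outer factor of the correction is zero. In the remaining case its two minus signs cancel, and
  subtracting the relay path from the negated direct path gives the negated full transfer.\<close>

lemma relay_path_block:
  assumes p: "p \<in> set (aux_blocks @ rx_blocks)" and q: "q \<in> set (aux_blocks @ rx_blocks)"
  shows "lin_block N dax Ktx Krx K k l p q -
      (case p of Out (Rx m) \<Rightarrow> - relays_to_rx N K m | _ \<Rightarrow> 0\<^sub>m (sz p) relay_dim)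
      * mat_inv (loop_mat N K) *
      (if q = Aux k then - (tx_to_relays N * Ktx k) else 0\<^sub>m relay_dim (sz q)) =
    eliminated_block k l p q"
proof -
  let ?J = "mat_inv (loop_mat N K)"
  note J = mat_inv_loop_mat(1) and R = relays_to_rx_carrier and T = tx_to_relays_carrier
  have TK: "tx_to_relays N * Ktx k \<in> carrier_mat relay_dim (dax k)"
    using T Ktx by (rule mult_carrier_mat)
  have RJ: "relays_to_rx N K m * ?J \<in> carrier_mat (n_out N (Rx m)) relay_dim" for m
    using R J by (rule mult_carrier_mat)
  have RJT: "relays_to_rx N K m * ?J * (tx_to_relays N * Ktx k) \<in> carrier_mat (n_out N (Rx m)) (dax k)" for m
    using RJ TK by (rule mult_carrier_mat)
  have HK: "chan N Tx (Rx m) * Ktx k \<in> carrier_mat (n_out N (Rx m)) (dax k)" for m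
    using chan_tx_rx_carrier Ktx by (rule mult_carrier_mat)
  have sub0: "X - 0\<^sub>m r c = X" if "X \<in> carrier_mat r c" for X :: "'f mat" and r c
    using that by (intro eq_matI) auto
  have gain: "transfer N K m * Ktx k =
      chan N Tx (Rx m) * Ktx k + relays_to_rx N K m * ?J * (tx_to_relays N * Ktx k)" for m
    unfolding transfer_eq assoc_mult_mat[OF RJ T Ktx, symmetric]
    by (rule add_mult_distrib_mat[OF chan_tx_rx_carrier mult_carrier_mat[OF RJ T] Ktx])
  have path: "- relays_to_rx N K m * ?J * - (tx_to_relays N * Ktx k) =
      relays_to_rx N K m * ?J * (tx_to_relays N * Ktx k)" for m
    using R[of m] J T Ktx[of k] TK RJ[of m] RJT[of m] by simp
  have neg: "- X - Y = - (X + Y)" if "X \<in> carrier_mat r c" "Y \<in> carrier_mat r c"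
    for X Y :: "'f mat" and r c
    using that by (intro eq_matI) auto
  show ?thesis
  proof (cases p)
    case (Aux m)
    moreover have "lin_block N dax Ktx Krx K k l (Aux m) q \<in> carrier_mat (dax m) (sz q)"
      using Krx[of l] q by auto
    moreover have "0\<^sub>m (dax m) relay_dim * - (tx_to_relays N * Ktx k) = 0\<^sub>m (dax m) (dax k)"
      using TK by (intro left_mult_zero_mat) auto
    ultimately show ?thesis
      using J q by (auto simp: sub0)
  next
    case (Out j)
    then obtain m where m: "p = Out (Rx m)" using p by auto
    show ?thesis
    proof (cases "q = Aux k")
      case True
      then show ?thesis using m gain path neg[OF HK RJT] by simp
    next
      case False
      have "lin_block N dax Ktx Krx K k l p q \<in> carrier_mat (sz p) (sz q)"
        using False q m by auto
      moreover have "- relays_to_rx N K m * ?J * 0\<^sub>m relay_dim (sz q) = 0\<^sub>m (n_out N (Rx m)) (sz q)"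
        using R[of m] J by (intro right_mult_zero_mat) auto
      moreover have "lin_block N dax Ktx Krx K k l p q = eliminated_block k l p q"
        using False q m by auto
      ultimately show ?thesis using False m by (simp add: sub0)
    qed
  qed
qed

lemma mat_rank_eliminate_relays:
  "mat_rank (lin_transfer N dax Ktx Krx K k l) =
    mat_rank (block_mat sz sz (aux_blocks @ rx_blocks) (aux_blocks @ rx_blocks) (eliminated_block k l))
    + relay_dim"
proof -
  let ?top = "aux_blocks @ rx_blocks" and ?b = "lin_block N dax Ktx Krx K k l"
    and ?J = "mat_inv (loop_mat N K)"
  let ?u = "\<lambda>p. case p of Out (Rx m) \<Rightarrow> - relays_to_rx N K m | _ \<Rightarrow> 0\<^sub>m (sz p) relay_dim"
  let ?w = "\<lambda>q. if q = Aux k then - (tx_to_relays N * Ktx k) else 0\<^sub>m relay_dim (sz q)"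
  let ?A = "block_mat sz sz ?top ?top ?b" and ?B = "block_mat sz sz ?top relay_blocks ?b"
    and ?C = "block_mat sz sz relay_blocks ?top ?b"
  have blocks: "blocks N = ?top @ relay_blocks" by (simp add: blocks_def)
  have u: "?u p \<in> carrier_mat (sz p) relay_dim" for p
    using relays_to_rx_carrier by (auto split: block.split node.split)
  have w: "?w q \<in> carrier_mat relay_dim (sz q)" for q
    using mult_carrier_mat[OF tx_to_relays_carrier Ktx] by auto
  \<comment> \<open>The relay part of the matrix is the loop matrix itself, so
    \<open>mat_inv_loop_mat\<close> supplies the inverse for the Schur complement.\<close>
  have loop: "block_mat sz sz relay_blocks relay_blocks ?b = loop_mat N K"
    unfolding loop_mat_def block_mat_map size_relay_block
    by (rule block_mat_cong) auto
  have "mat_rank (lin_transfer N dax Ktx Krx K k l) = mat_rank (four_block_mat ?A ?B ?C (loop_mat N K))"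
    unfolding lin_transfer_eq_block_mat blocks block_mat_append[of sz sz ?top relay_blocks] loop ..
  also have "\<dots> = mat_rank (?A - ?B * ?J * ?C) + relay_dim"
  proof (rule mat_rank_schur_complement)
    show "?B \<in> carrier_mat (sum_list (map sz ?top)) relay_dim"
      "?C \<in> carrier_mat relay_dim (sum_list (map sz ?top))"
      by (rule carrier_matI; simp add: comp_def)+
  qed (rule block_mat_carrier loop_mat_carrier mat_inv_loop_mat)+
  also have "?A - ?B * ?J * ?C = ?A - block_mat sz sz ?top ?top (\<lambda>p q. ?u p * ?J * ?w q)"
    unfolding lin_block_relay_columns lin_block_relay_rows
    by (subst block_mat_sandwich[OF u mat_inv_loop_mat(1) w]) (rule refl)
  also have "\<dots> = block_mat sz sz ?top ?top (\<lambda>p q. ?b p q - ?u p * ?J * ?w q)"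
    by (rule block_mat_minus) (rule mult_carrier_mat[OF mult_carrier_mat[OF u mat_inv_loop_mat(1)] w])
  also have "\<dots> = block_mat sz sz ?top ?top (eliminated_block k l)"
    by (rule block_mat_cong) (rule relay_path_block)
  finally show ?thesis .
qed

section \<open>Elimination of the receivers\<close>

text \<open>The receiver part is now an identity matrix. Its Schur complement lives on the auxiliary
  blocks and has \<open>- ?X\<close> as its only possibly nonzero block, at row \<open>Aux l\<close>
  and column \<open>Aux k\<close>; embedding a matrix into a larger zero matrix preserves its
  rank.\<close>

lemma mat_rank_eliminate_receivers:
  "mat_rank (block_mat sz sz (aux_blocks @ rx_blocks) (aux_blocks @ rx_blocks) (eliminated_block k l)) =
    mat_rank (Krx l * transfer N K l * Ktx k) + (n_out N (Rx U1) + n_out N (Rx U2))"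
proof -
  let ?X = "Krx l * transfer N K l * Ktx k" and ?r = "n_out N (Rx U1) + n_out N (Rx U2)"
    and ?a = "dax U1 + dax U2" and ?b = "eliminated_block k l"
  \<comment> \<open>\<open>?E\<close> embeds the block of user \<open>l\<close> into the auxiliary
    rows, and \<open>?F\<close> places the block of user \<open>k\<close> in the auxiliary
    columns.\<close>
  let ?E = "\<lambda>p _. if p = Aux l then 1\<^sub>m (dax l) else 0\<^sub>m (sz p) (dax l)"
    and ?F = "\<lambda>_ q. if q = Aux k then 1\<^sub>m (dax k) else 0\<^sub>m (dax k) (sz q)"
  have X: "?X \<in> carrier_mat (dax l) (dax k)"
    using mult_carrier_mat[OF mult_carrier_mat[OF Krx transfer_carrier] Ktx] .
  then have X': "- ?X \<in> carrier_mat (dax l) (dax k)"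
    by simp
  have GK: "transfer N K m * Ktx k \<in> carrier_mat (n_out N (Rx m)) (dax k)" for m
    using transfer_carrier Ktx by (rule mult_carrier_mat)
  have aux: "Aux m \<in> set aux_blocks" and rx: "Out (Rx m) \<in> set rx_blocks" for m
    by (cases m; simp)+
  let ?B = "block_mat sz sz aux_blocks rx_blocks ?b" and ?C = "block_mat sz sz rx_blocks aux_blocks ?b"
  have "block_mat sz sz aux_blocks aux_blocks ?b =
      block_mat sz sz aux_blocks aux_blocks (\<lambda>p q. 0\<^sub>m (sz p) (sz q))"
    by (rule block_mat_cong) auto
  then have A: "block_mat sz sz aux_blocks aux_blocks ?b = 0\<^sub>m ?a ?a"
    using block_mat_zero[of sz sz aux_blocks aux_blocks] by simp
  have "block_mat sz sz rx_blocks rx_blocks ?b =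
      block_mat sz sz rx_blocks rx_blocks (\<lambda>p q. if p = q then 1\<^sub>m (sz p) else 0\<^sub>m (sz p) (sz q))"
    by (rule block_mat_cong) auto
  then have D: "block_mat sz sz rx_blocks rx_blocks ?b = 1\<^sub>m ?r"
    using block_mat_one[of rx_blocks sz] by simp
  have B: "?B \<in> carrier_mat ?a ?r" and C: "?C \<in> carrier_mat ?r ?a"
    by (rule carrier_matI; simp)+
  have E: "block_mat sz (\<lambda>_. dax l) aux_blocks [()] ?E \<in> carrier_mat ?a (dax l)"
    and E': "block_mat (\<lambda>_. dax l) sz [()] aux_blocks (\<lambda>_ p. if p = Aux l then 1\<^sub>m (dax l) else 0\<^sub>m (dax l) (sz p))
      \<in> carrier_mat (dax l) ?a"
    and F: "block_mat (\<lambda>_. dax k) sz [()] aux_blocks ?F \<in> carrier_mat (dax k) ?a"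
    and F': "block_mat sz (\<lambda>_. dax k) aux_blocks [()] (\<lambda>p _. if p = Aux k then 1\<^sub>m (dax k) else 0\<^sub>m (sz p) (dax k))
      \<in> carrier_mat ?a (dax k)"
    by (rule carrier_matI; simp)+
  \<comment> \<open>Selecting a block after embedding it is the identity. For \<open>n = l\<close>
    this is a left inverse of the row embedding, for \<open>n = k\<close> a right inverse of the
    column placement.\<close>
  have unit: "block_mat (\<lambda>_. dax n) sz [()] aux_blocks (\<lambda>_ p. if p = Aux n then 1\<^sub>m (dax n) else 0\<^sub>m (dax n) (sz p))
      * block_mat sz (\<lambda>_. dax n) aux_blocks [()] (\<lambda>p _. if p = Aux n then 1\<^sub>m (dax n) else 0\<^sub>m (sz p) (dax n))
      = (1\<^sub>m (dax n) :: 'f mat)" (is "block_mat _ _ _ _ ?f * block_mat _ _ _ _ ?g = _") for n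
  proof -
    have "block_mat (\<lambda>_. dax n) sz [()] aux_blocks ?f * block_mat sz (\<lambda>_. dax n) aux_blocks [()] ?g =
        block_mat (\<lambda>_. dax n) (\<lambda>_. dax n) [()] [()] (\<lambda>r c. ?f r (Aux n) * ?g (Aux n) c)"
      by (rule block_mat_mult_single) (use aux in auto)
    then show ?thesis by (simp add: block_mat_unit)
  qed
  have "mat_rank (block_mat sz sz (aux_blocks @ rx_blocks) (aux_blocks @ rx_blocks) ?b) =
      mat_rank (four_block_mat (0\<^sub>m ?a ?a) ?B ?C (1\<^sub>m ?r))"
    unfolding block_mat_append[of sz sz aux_blocks rx_blocks] A D ..
  also have "\<dots> = mat_rank (0\<^sub>m ?a ?a - ?B * 1\<^sub>m ?r * ?C) + ?r"
    by (rule mat_rank_schur_complement[OF _ B C]) auto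
  also have "?B * 1\<^sub>m ?r * ?C = ?B * ?C"
    using B by simp
  \<comment> \<open>Only the gain of receiver \<open>l\<close> enters the auxiliary rows, so
    \<open>Out (Rx l)\<close> is the only middle block that contributes.\<close>
  also have "?B * ?C = block_mat sz sz aux_blocks aux_blocks (\<lambda>p q. ?b p (Out (Rx l)) * ?b (Out (Rx l)) q)"
  proof (rule block_mat_mult_single)
    show "?b p q \<in> carrier_mat (sz p) (sz q)" if "p \<in> set aux_blocks" "q \<in> set rx_blocks" for p q
      using that Krx[of l] by auto
    show *: "?b p q \<in> carrier_mat (sz p) (sz q)" if "q \<in> set aux_blocks" "p \<in> set rx_blocks" for p q
      using that GK by auto
    show "?b p s * ?b s q = 0\<^sub>m (sz p) (sz q)"
      if "p \<in> set aux_blocks" "s \<in> set rx_blocks" "q \<in> set aux_blocks" "s \<noteq> Out (Rx l)" for p s q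
    proof -
      have "?b p s = 0\<^sub>m (sz p) (sz s)" using that by auto
      then show ?thesis using *[OF that(3,2)] by simp
    qed
  qed (use rx in simp_all)
  also have "0\<^sub>m ?a ?a - \<dots> = block_mat sz sz aux_blocks aux_blocks
      (\<lambda>p q. 0\<^sub>m (sz p) (sz q) - ?b p (Out (Rx l)) * ?b (Out (Rx l)) q)"
  proof -
    have zero: "(0\<^sub>m ?a ?a :: 'f mat) = block_mat sz sz aux_blocks aux_blocks (\<lambda>p q. 0\<^sub>m (sz p) (sz q))"
      by (simp add: block_mat_zero)
    show ?thesis
      unfolding zero
    proof (rule block_mat_minus)
      fix p q assume "p \<in> set aux_blocks" "q \<in> set aux_blocks"
      then show "?b p (Out (Rx l)) * ?b (Out (Rx l)) q \<in> carrier_mat (sz p) (sz q)"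
        using Krx[of l] GK by (intro mult_carrier_mat[where n = "n_out N (Rx l)"]) auto
    qed
  qed
  also have "\<dots> = block_mat sz sz aux_blocks aux_blocks (\<lambda>p q. ?E p () * (- ?X) * ?F () q)"
  proof (rule block_mat_cong)
    fix p q assume p: "p \<in> set aux_blocks" and q: "q \<in> set aux_blocks"
    have zero_minus: "0\<^sub>m r c - Y = - Y" if "Y \<in> carrier_mat r c" for Y :: "'f mat" and r c
      using that by (intro eq_matI) auto
    have neg_mult_neg: "- Y * - Z = Y * Z" if "Y \<in> carrier_mat r s" "Z \<in> carrier_mat s c"
      for Y Z :: "'f mat" and r s c
      using that by simp
    have assoc: "Krx l * (transfer N K l * Ktx k) = ?X"
      by (rule assoc_mult_mat[OF Krx transfer_carrier Ktx, symmetric])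
    show "0\<^sub>m (sz p) (sz q) - ?b p (Out (Rx l)) * ?b (Out (Rx l)) q = ?E p () * (- ?X) * ?F () q"
    proof (cases "p = Aux l \<and> q = Aux k")
      case True
      have "- Krx l * - (transfer N K l * Ktx k) = ?X"
        unfolding assoc[symmetric]
        by (rule neg_mult_neg[OF Krx GK])
      moreover have "1\<^sub>m (dax l) * - ?X * 1\<^sub>m (dax k) = - ?X"
        using left_mult_one_mat[OF X'] right_mult_one_mat[OF X'] by simp
      ultimately show ?thesis using True X by (simp add: zero_minus)
    next
      case False
      have bp: "?b p (Out (Rx l)) \<in> carrier_mat (sz p) (n_out N (Rx l))"
        and bq: "?b (Out (Rx l)) q \<in> carrier_mat (n_out N (Rx l)) (sz q)"
        using p q Krx[of l] GK[of l] by auto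
      have Ep: "?E p () * - ?X \<in> carrier_mat (sz p) (dax k)" and Fq: "?F () q \<in> carrier_mat (dax k) (sz q)"
        using mult_carrier_mat[OF _ X'] by auto
      have minus: "0\<^sub>m r c - 0\<^sub>m r c = (0\<^sub>m r c :: 'f mat)" for r c
        by auto
      consider "p \<noteq> Aux l" | "q \<noteq> Aux k" using False by blast
      then show ?thesis
      proof cases
        case 1
        moreover from 1 have "?b p (Out (Rx l)) = 0\<^sub>m (sz p) (n_out N (Rx l))"
          using p by auto
        ultimately show ?thesis
          by (simp only: if_False left_mult_zero_mat[OF bq] left_mult_zero_mat[OF X']
              left_mult_zero_mat[OF Fq] minus)
      next
        case 2
        moreover from 2 have "?b (Out (Rx l)) q = 0\<^sub>m (n_out N (Rx l)) (sz q)"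
          using q by auto
        ultimately show ?thesis
          by (simp only: if_False right_mult_zero_mat[OF bp] right_mult_zero_mat[OF Ep] minus)
      qed
    qed
  qed
  also have "\<dots> = block_mat sz (\<lambda>_. dax l) aux_blocks [()] ?E * (- ?X)
      * block_mat (\<lambda>_. dax k) sz [()] aux_blocks ?F"
    by (rule block_mat_sandwich[symmetric]) (use X in auto)
  also have "mat_rank \<dots> = mat_rank (block_mat sz (\<lambda>_. dax l) aux_blocks [()] ?E * (- ?X))"
    by (rule mat_rank_mult_right_inverse[OF mult_carrier_mat[OF E X'] F F' unit])
  also have "\<dots> = mat_rank (- ?X)"
    by (rule mat_rank_mult_left_inverse[OF E E' X' unit])
  also have "\<dots> = mat_rank ?X"
    by (rule mat_rank_uminus)
  finally show ?thesis .
qed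

section \<open>The rank formula and the equivalence\<close>

lemma mat_rank_lin_transfer:
  "mat_rank (lin_transfer N dax Ktx Krx K k l) =
    n_out N (Rx U1) + n_out N (Rx U2) + (\<Sum>i = 1..n_relays N. relay_out N i)
    + mat_rank (Krx l * transfer N K l * Ktx k)"
  unfolding mat_rank_eliminate_relays mat_rank_eliminate_receivers relay_dim_eq by simp

end

theorem theorem14:
  fixes N :: "'a::field poly fract network"
    and dax :: "user \<Rightarrow> nat"
    and Ktx Krx :: "user \<Rightarrow> 'a poly fract mat"
    and K :: "nat \<Rightarrow> 'a poly fract mat"
    and d d1 d2 d3 d4 :: nat
  assumes "lti_network N"
    and "\<And>k. dax k > 0"
    and "\<And>k. Ktx k \<in> carrier_mat (n_in N Tx) (dax k)"
    and "\<And>i. i \<in> {1..n_relays N} \<Longrightarrow> K i \<in> carrier_mat (n_in N (Relay i)) (n_out N (Relay i))"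
    and "\<And>k. Krx k \<in> carrier_mat (dax k) (n_out N (Rx k))"
    and "invertible_mat (loop_mat N K)"
    and "d = n_out N (Rx U1) + n_out N (Rx U2) + (\<Sum>i = 1..n_relays N. n_out N (Relay i))"
  shows "(mat_rank (Krx U1 * transfer N K U1 * Ktx U1) \<ge> d1 \<and>
          mat_rank (Krx U2 * transfer N K U2 * Ktx U2) \<ge> d2 \<and>
          mat_rank (Krx U2 * transfer N K U2 * Ktx U1) \<le> d3 \<and>
          mat_rank (Krx U1 * transfer N K U1 * Ktx U2) \<le> d4) \<longleftrightarrow>
         (mat_rank (lin_transfer N dax Ktx Krx K U1 U1) \<ge> d + d1 \<and>
          mat_rank (lin_transfer N dax Ktx Krx K U2 U2) \<ge> d + d2 \<and>
          mat_rank (lin_transfer N dax Ktx Krx K U1 U2) \<le> d + d3 \<and>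
          mat_rank (lin_transfer N dax Ktx Krx K U2 U1) \<le> d + d4)"
proof -
  interpret linearized_network N dax Ktx Krx K
    by unfold_locales (fact assms)+
  \<comment> \<open>Each linearized rank is \<open>d\<close> plus the rank of the matching product.
    The user pairs are (1,1), (2,2), (1,2) and (2,1), transmitter gain first, so each inequality is
    equivalent to its counterpart shifted by \<open>d\<close>.\<close>
  show ?thesis
    by (simp add: mat_rank_lin_transfer assms(7))
qed

end
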